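(* Let $G_1,\dots,G_t$ be $p$-homological connected graphs, and let $k=\max\{t,p,3\}$. Then $f(G_1\cup G_2\cup\cdots\cup G_t,P_5)\leq R_k(G_1\cup G_2\cup\cdots\cup G_t)$.
   Context: $G_1\cup\cdots\cup G_t$ denotes the vertex-disjoint union. Graphs $G_1,\dots,G_t$ of the same order are called $p$-homological if $\max_{i}\chi(G_i)=p$ and there exist positive integers $s_1,\dots,s_p$ such that every $G_i$ admits a proper $p$-vertex-coloring in which, for each $j\in\{1,\dots,p\}$, exactly $s_j$ vertices receive color $j$ (equivalently, all $G_i$ are spanning subgraphs of $K_{s_1,\dots,s_p}$). $P_5$ is the path on $5$ vertices. Monochromatic: all edges same color; rainbow: all edges distinct colors. $f(H,G)$ is the minimum $n$ such that every edge-coloring of $K_n$ with any number of colors contains a monochromatic $H$ or a rainbow $G$. $R_k(H)$ is the minimum $n$ such that every coloring of $E(K_n)$ with colors from $\{1,\dots,k\}$ (not all need be used) contains a monochromatic $H$. *)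

theory Defs
  imports Main "HOL-Library.Ramsey"
begin

record 'a sgraph =
  verts :: "'a set"
  edges :: "'a set set"

definition simple_graph :: "'a sgraph \<Rightarrow> bool" where
  "simple_graph G \<longleftrightarrow> finite (verts G) \<and> edges G \<subseteq> nsets (verts G) 2"

definition connected_graph :: "'a sgraph \<Rightarrow> bool" where
  "connected_graph G \<longleftrightarrow> verts G \<noteq> {} \<and>
     (\<forall>u\<in>verts G. \<forall>v\<in>verts G. (u, v) \<in> {(x, y). {x, y} \<in> edges G}\<^sup>*)"

definition proper_vertex_coloring :: "'a sgraph \<Rightarrow> nat \<Rightarrow> ('a \<Rightarrow> nat) \<Rightarrow> bool" where
  "proper_vertex_coloring G p c \<longleftrightarrow>
     c ` verts G \<subseteq> {1..p} \<and> (\<forall>u v. {u, v} \<in> edges G \<longrightarrow> c u \<noteq> c v)"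

definition chromatic_number :: "'a sgraph \<Rightarrow> nat" where
  "chromatic_number G = (LEAST p. \<exists>c. proper_vertex_coloring G p c)"

definition homological :: "nat \<Rightarrow> nat \<Rightarrow> (nat \<Rightarrow> 'a sgraph) \<Rightarrow> bool" where
  "homological p t G \<longleftrightarrow>
     (\<forall>i\<in>{1..t}. \<forall>j\<in>{1..t}. card (verts (G i)) = card (verts (G j))) \<and>
     Max ((\<lambda>i. chromatic_number (G i)) ` {1..t}) = p \<and>
     (\<exists>s :: nat \<Rightarrow> nat. (\<forall>j\<in>{1..p}. 0 < s j) \<and>
        (\<forall>i\<in>{1..t}. \<exists>c. proper_vertex_coloring (G i) p c \<and>
           (\<forall>j\<in>{1..p}. card {v \<in> verts (G i). c v = j} = s j)))"

text \<open>Vertices are tagged with the index of their component, so that the vertex sets of the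
  \<open>G i\<close> need not be disjoint beforehand.\<close>

definition disjoint_union :: "nat \<Rightarrow> (nat \<Rightarrow> 'a sgraph) \<Rightarrow> (nat \<times> 'a) sgraph" where
  "disjoint_union t G =
     \<lparr> verts = (SIGMA i:{1..t}. verts (G i)),
       edges = (\<Union>i\<in>{1..t}. (\<lambda>e. Pair i ` e) ` edges (G i)) \<rparr>"

definition complete_graph :: "nat \<Rightarrow> nat sgraph" where
  "complete_graph n = \<lparr> verts = {..<n}, edges = nsets {..<n} 2 \<rparr>"

definition path_graph :: "nat \<Rightarrow> nat sgraph" where
  "path_graph n = \<lparr> verts = {..<n}, edges = {{i, Suc i} | i. Suc i < n} \<rparr>"

text \<open>\<open>embeds \<phi> H K\<close>: the map \<open>\<phi>\<close> exhibits a copy of \<open>H\<close> as a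
  (not necessarily induced) subgraph of \<open>K\<close>.\<close>

definition embeds :: "('a \<Rightarrow> 'b) \<Rightarrow> 'a sgraph \<Rightarrow> 'b sgraph \<Rightarrow> bool" where
  "embeds \<phi> H K \<longleftrightarrow>
     inj_on \<phi> (verts H) \<and> \<phi> ` verts H \<subseteq> verts K \<and> (\<forall>e\<in>edges H. \<phi> ` e \<in> edges K)"

definition has_monochromatic :: "'b sgraph \<Rightarrow> ('b set \<Rightarrow> nat) \<Rightarrow> 'a sgraph \<Rightarrow> bool" where
  "has_monochromatic K c H \<longleftrightarrow>
     (\<exists>\<phi>. embeds \<phi> H K \<and> (\<exists>a. \<forall>e\<in>edges H. c (\<phi> ` e) = a))"

definition has_rainbow :: "'b sgraph \<Rightarrow> ('b set \<Rightarrow> nat) \<Rightarrow> 'a sgraph \<Rightarrow> bool" where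
  "has_rainbow K c H \<longleftrightarrow>
     (\<exists>\<phi>. embeds \<phi> H K \<and> inj_on (\<lambda>e. c (\<phi> ` e)) (edges H))"

text \<open>\<open>mono_rainbow_number H G\<close> is $f(H,G)$. As \<open>complete_graph n\<close> is finite, colors in
  \<^typ>\<open>nat\<close> account for every number of colors.\<close>

definition mono_rainbow_number :: "'a sgraph \<Rightarrow> 'b sgraph \<Rightarrow> nat" where
  "mono_rainbow_number H G =
     (LEAST n. \<forall>c. has_monochromatic (complete_graph n) c H \<or>
                   has_rainbow (complete_graph n) c G)"

definition ramsey_number :: "nat \<Rightarrow> 'a sgraph \<Rightarrow> nat" where
  "ramsey_number k H =
     (LEAST n. \<forall>c. c ` edges (complete_graph n) \<subseteq> {1..k} \<longrightarrow>
                   has_monochromatic (complete_graph n) c H)"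

end

theory Submission
  imports Defs
begin

text \<open>
  Let \<open>n\<close> be the \<open>k\<close>-color Ramsey number of the disjoint union \<open>H\<close>, and let \<open>K\<^sub>n\<close> be colored without a
  rainbow \<open>P\<^sub>5\<close>. Call two colors adjacent if they occur on two edges sharing a vertex. If at least
  four colors are used and no color meets all adjacent pairs, then there are two disjoint adjacent
  pairs, and excluding rainbow \<open>P\<^sub>5\<close>s these produce a rainbow paw (a triangle with a pendant edge)
  that forces almost all edges of \<open>K\<^sub>n\<close> into one color. As \<open>n \<ge> |H| + 2\<close>, and \<open>n \<ge> |H| + 3\<close>
  for complete \<open>H\<close>, that color then contains \<open>H\<close>.

  It remains to treat a dominating color \<open>q\<close>: the vertex sets \<open>U\<^sub>j\<close> of the other colors \<open>j\<close> are
  disjoint and all edges between them have color \<open>q\<close>. If at least \<open>k\<close> of them have as many vertices as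
  a component of \<open>H\<close>, then \<open>H\<close> embeds across them in color \<open>q\<close>. Otherwise recolor with \<open>k\<close> colors,
  merging the small classes; these contain no component of \<open>H\<close>, so a monochromatic \<open>H\<close> in the new
  coloring is one in the old.
\<close>

section \<open>Colorings without a rainbow path on five vertices\<close>

locale p5_free =
  fixes V :: "'v set" and f :: "'v \<Rightarrow> 'v \<Rightarrow> 'c"
  assumes sym: "f x y = f y x"
    and path: "\<lbrakk>distinct [v, w, x, y, z]; {v, w, x, y, z} \<subseteq> V\<rbrakk>
      \<Longrightarrow> \<not> distinct [f v w, f w x, f x y, f y z]"
begin

text \<open>In a properly colored K_5 a path can repeat a color only on disjoint edges, and the six
  paths used below cannot all do so.\<close>

lemma not_proper:
  assumes V: "distinct [a, b, c, d, e]" "{a, b, c, d, e} \<subseteq> V"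
  obtains (ex) x y z where "x \<in> {a, b, c, d, e}" "y \<in> {a, b, c, d, e}" "z \<in> {a, b, c, d, e}"
    "distinct [x, y, z]" "f x y = f x z"
proof (rule ccontr)
  assume neg: "\<not> thesis"
  have proper: "f x y \<noteq> f x z" if "x \<in> {a, b, c, d, e}" "y \<in> {a, b, c, d, e}"
    "z \<in> {a, b, c, d, e}" "distinct [x, y, z]" for x y z
    using neg ex that by blast
  \<comment> \<open>Orienting each of the ten pairs one way turns the path conditions into a finite
    problem about ten colors.\<close>
  have S: "f b a = f a b" "f c a = f a c" "f c b = f b c" "f d a = f a d" "f d b = f b d"
    "f d c = f c d" "f e a = f a e" "f e b = f b e" "f e c = f c e" "f e d = f d e"
    by (simp_all add: sym)
  have "distinct [f a b, f a c, f a d, f a e]" "distinct [f b a, f b c, f b d, f b e]"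
    "distinct [f c a, f c b, f c d, f c e]" "distinct [f d a, f d b, f d c, f d e]"
    "distinct [f e a, f e b, f e c, f e d]"
    using V(1) distinct_rev[of "[a, b, c, d, e]"] by (simp_all add: proper)
  then show False
    using V path[of a d b e c] path[of a e d b c] path[of a e b d c] path[of b c d a e]
      path[of a d e b c] path[of b a c d e]
    by (simp add: S) (smt (verit))
qed

section \<open>Rainbow paws and the color they force\<close>

text \<open>The vertex \<open>a\<close> has degree three and \<open>d\<close> is the leaf; the
  triangle is \<open>a b c\<close>.\<close>

definition paw :: "'v \<Rightarrow> 'v \<Rightarrow> 'v \<Rightarrow> 'v \<Rightarrow> bool" where
  "paw a b c d \<longleftrightarrow> distinct [a, b, c, d] \<and> {a, b, c, d} \<subseteq> V \<and>
     distinct [f a b, f a c, f b c, f a d]"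

text \<open>The path \<open>e d a b c\<close> leaves for \<open>f d e\<close> only the colors of
  \<open>a d\<close>, \<open>a b\<close>, \<open>b c\<close>, and the path \<open>e d a c b\<close>
  only those of \<open>a d\<close>, \<open>a c\<close>, \<open>b c\<close>.\<close>

lemma paw_outside_color:
  assumes "paw a b c d" "e \<in> V - {a, b, c, d}"
  shows "f d e = f b c \<or> f d e = f a d"
  using assms path[of e d a b c] path[of e d a c b]
  by (simp add: paw_def) (metis sym)

text \<open>A check of paths on six vertices: if \<open>b e\<close> had another color than
  \<open>b c\<close>, one of the listed paths would be rainbow. The vertex \<open>x\<close> supplies
  further paths.\<close>

lemma paw_triangle_color_step:
  assumes "paw a b c d" and out: "e \<in> V - {a, b, c, d}" "x \<in> V - {a, b, c, d}" "e \<noteq> x"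
    and "f d e = f b c"
  shows "f b e = f b c"
proof -
  have S: "f b a = f a b" "f c a = f a c" "f c b = f b c" "f d a = f a d" "f d b = f b d"
    "f d c = f c d" "f e a = f a e" "f e b = f b e" "f e c = f c e" "f e d = f d e"
    "f x a = f a x" "f x b = f b x" "f x c = f c x" "f x d = f d x" "f x e = f e x"
    by (simp_all add: sym)
  show ?thesis
    using assms path[of e b c a x] path[of a b x e d] path[of c a b x d] path[of b x d a c]
      path[of d a c e x] path[of b a d e x] path[of e b a d x] path[of c a d b e] path[of b a c e x]
      path[of c a b e d] path[of b c a d x] path[of b c a x d] path[of c b a d x] path[of a x d e b]
      path[of c a d e x] path[of e b d a x] path[of c a b d e] path[of b e x a d] path[of a b e d x]
      path[of b d a c e] path[of c a b x e] path[of a d b c e] path[of b e x a c] path[of c b d a x]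
    by (simp add: paw_def S) (smt (verit))
qed

text \<open>The mirror symmetry of the paw: what is shown for \<open>b\<close> then also holds for
  \<open>c\<close>.\<close>

lemma paw_swap: "paw a b c d \<Longrightarrow> paw a c b d"
  by (auto simp: paw_def sym[of c b])

text \<open>The color of \<open>b c\<close> spreads from \<open>d e\<close> first to
  \<open>b e\<close> and \<open>c e\<close>, by the one-step lemma and its mirror image, then to
  \<open>d x\<close>. Now \<open>x\<close> is in the same position as \<open>e\<close>, and
  \<open>e x\<close> follows.\<close>

lemma paw_triangle_color:
  assumes paw: "paw a b c d" and out: "e \<in> V - {a, b, c, d}" "x \<in> V - {a, b, c, d}" "e \<noteq> x"
    and de: "f d e = f b c"
  shows "f b e = f b c" "f c e = f b c" "f d x = f b c" "f e x = f b c"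
proof -
  have S: "f b a = f a b" "f c a = f a c" "f c b = f b c" "f d a = f a d" "f d b = f b d"
    "f d c = f c d" "f e a = f a e" "f e b = f b e" "f e c = f c e" "f e d = f d e"
    "f x a = f a x" "f x b = f b x" "f x c = f c x" "f x d = f d x" "f x e = f e x"
    by (simp_all add: sym)
  have step: "f b e = f b c \<and> f c e = f b c"
    if "e \<in> V - {a, b, c, d}" "x \<in> V - {a, b, c, d}" "e \<noteq> x" "f d e = f b c" for e x
    using paw_triangle_color_step[OF paw, of e x] paw_triangle_color_step[OF paw_swap[OF paw], of e x]
      that by (auto simp: sym[of c b])
  show e: "f b e = f b c" "f c e = f b c"
    using step[OF out de] by auto
  show dx: "f d x = f b c"
    using paw out de e path[of e c a d x] path[of a b x d e] path[of c b a d x] path[of c a b x d]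
      path[of d a c b x] path[of e c a b x]
    by (simp add: paw_def S) (smt (verit))
  show "f e x = f b c"
    using paw out de e dx step[of x e] path[of d a c e x] path[of b a c e x] path[of d a b x e]
    by (simp add: paw_def S) (smt (verit))
qed

text \<open>The complementary case: \<open>d\<close> sends the color of \<open>a d\<close> outside.
  An edge of another color from a corner of the triangle to \<open>e\<close> forces the other two
  corners to see \<open>x\<close> and \<open>d\<close> in the color of \<open>a d\<close>. What is
  not stated for \<open>c\<close> comes by \<open>paw_swap\<close>.\<close>

lemma paw_pendant_color:
  assumes paw: "paw a b c d" and out: "e \<in> V - {a, b, c, d}" "x \<in> V - {a, b, c, d}" "e \<noteq> x"
    and d: "f d e = f a d" "f d x = f a d"
  shows "f e x = f a d"
    and "f a e \<noteq> f a d \<Longrightarrow> f b x = f a d \<and> f b d = f a d"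
    and "f b e \<noteq> f a d \<Longrightarrow> f a x = f a d \<and> f c x = f a d \<and> f c d = f a d"
proof -
  have S: "f b a = f a b" "f c a = f a c" "f c b = f b c" "f d a = f a d" "f d b = f b d"
    "f d c = f c d" "f e a = f a e" "f e b = f b e" "f e c = f c e" "f e d = f d e"
    "f x a = f a x" "f x b = f b x" "f x c = f c x" "f x d = f d x" "f x e = f e x"
    by (simp_all add: sym)
  show ex: "f e x = f a d"
    using paw out d path[of c a b e d] path[of d a b e x] path[of c a b e x] path[of e b c d x]
      path[of a c b e x] path[of b c d x e] path[of c b a x e] path[of b c a x d] path[of b a x e d]
      path[of a c b e d] path[of c b a x d] path[of a b e d c] path[of d c b e x]
    by (simp add: paw_def S) (smt (verit))
  show "f b x = f a d \<and> f b d = f a d" if "f a e \<noteq> f a d"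
    using that paw out d ex path[of c b a e d] path[of c a b x d] path[of d x b a e] path[of b x e a c]
      path[of b c a e d] path[of e a b d x] path[of a c b d x] path[of c a b d e]
    by (simp add: paw_def S) (smt (verit))
  show "f a x = f a d \<and> f c x = f a d \<and> f c d = f a d" if "f b e \<noteq> f a d"
    using that paw out d ex path[of b c a x e] path[of d c a x e] path[of d c a b e] path[of b a c d e]
      path[of b e x a c] path[of c b a x d] path[of a b e d c] path[of d e b a x] path[of b a c x d]
      path[of a c b e d] path[of d x c b e] path[of a b c x d] path[of a c x e b] path[of b a c d x]
      path[of a b c d e] path[of a c d e b] path[of a d c b e]
    by (simp add: paw_def S) (smt (verit))
qed

text \<open>For \<open>card V = 5\<close> this only asks for two edges of the same color at a common vertex.\<close>

definition near_clique :: "'c \<Rightarrow> 'v \<Rightarrow> 'v \<Rightarrow> 'v set \<Rightarrow> bool" where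
  "near_clique q a b X \<longleftrightarrow> a \<in> V \<and> b \<in> V \<and> a \<noteq> b \<and> X \<subseteq> V - {a, b} \<and> card V \<le> card X + 4 \<and>
     (\<forall>x\<in>X. \<forall>y\<in>X \<union> {a, b}. x \<noteq> y \<longrightarrow> f x y = q)"

text \<open>Of the four removed vertices, \<open>a\<close> and \<open>b\<close> remain attached in
  color \<open>q\<close>; only \<open>c\<close> and \<open>d\<close> are lost.\<close>

lemma near_cliqueI:
  assumes fin: "finite V" and abcd: "distinct [a, b, c, d]" "{a, b, c, d} \<subseteq> V"
    and "\<And>x y. \<lbrakk>x \<in> V - {a, b, c, d}; y \<in> V - {a, b, c, d}; x \<noteq> y\<rbrakk> \<Longrightarrow> f x y = q"
    and "\<And>x. x \<in> V - {a, b, c, d} \<Longrightarrow> f a x = q \<and> f b x = q"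
  shows "near_clique q a b (V - {a, b, c, d})"
proof -
  have "card (V - {a, b, c, d}) = card V - 4"
    using abcd fin by (subst card_Diff_subset) auto
  then show ?thesis
    using assms by (auto simp: near_clique_def sym)
qed

text \<open>By \<open>paw_outside_color\<close> the edges from \<open>d\<close> to the outside have
  the color of \<open>b c\<close> or of \<open>a d\<close>. If the first occurs once, it occurs
  always, and \<open>b\<close>, \<open>c\<close> are the attached pair. Otherwise the color is that
  of \<open>a d\<close>, and an outside vertex with a deviating edge to the triangle trades places
  with \<open>d\<close>.\<close>

lemma paw_imp_near_clique:
  assumes fin: "finite V" and V: "6 \<le> card V" and paw: "paw a b c d"
  shows "\<exists>q a b X. near_clique q a b X"
proof -
  define Out where "Out = V - {a, b, c, d}"
  have abcd: "distinct [a, b, c, d]" "{a, b, c, d} \<subseteq> V"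
    using paw by (auto simp: paw_def)
  have paw': "paw a c b d"
    using paw by (rule paw_swap)
  have "card Out = card V - 4"
    using abcd fin unfolding Out_def by (subst card_Diff_subset) auto
  \<comment> \<open>Six vertices leave at least two outside the paw, as the spreading lemmas
    require.\<close>
  then have other: "\<exists>x\<in>Out. x \<noteq> e" for e
    using V card_mono[of "{e}" Out] by force
  show ?thesis
  proof (cases "\<exists>e\<in>Out. f d e = f b c")
    case True
    then obtain e where e: "e \<in> Out" "f d e = f b c"
      by blast
    have d: "f d x = f b c" if "x \<in> Out" for x
      using paw_triangle_color(3)[OF paw, of e x] e that by (cases "x = e") (auto simp: Out_def)
    have bc: "f b x = f b c \<and> f c x = f b c" if "x \<in> Out" for x
      using paw_triangle_color(1,2)[OF paw, of x] other[of x] d[OF that] that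
      unfolding Out_def by metis
    have "f x y = f b c" if "x \<in> Out" "y \<in> Out" "x \<noteq> y" for x y
      using paw_triangle_color(4)[OF paw, of x y] d that by (auto simp: Out_def)
    moreover have "V - {b, c, a, d} = Out"
      by (auto simp: Out_def)
    ultimately have "near_clique (f b c) b c (V - {b, c, a, d})"
      using abcd bc by (intro near_cliqueI[OF fin]) auto
    then show ?thesis by blast
  next
    case False
    then have d: "f d x = f a d" if "x \<in> Out" for x
      using paw_outside_color[OF paw, of x] that by (auto simp: Out_def)
    have inner: "f x y = f a d" if "x \<in> Out" "y \<in> Out" "x \<noteq> y" for x y
      using paw_pendant_color(1)[OF paw, of x y] d that by (auto simp: Out_def)
    define clear where "clear u v e \<longleftrightarrow> (\<forall>x\<in>insert d Out - {e}. f u x = f a d \<and> f v x = f a d)" for u v e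
    \<comment> \<open>The deviating vertex \<open>e\<close> and the corner \<open>w\<close> at which
      it deviates are given up; \<open>d\<close> enters the clique, and the other corners
      \<open>u\<close>, \<open>v\<close> become the attached pair.\<close>
    have exchange: ?thesis if uvw: "(u, v, w) \<in> {(b, c, a), (a, c, b), (a, b, c)}"
      and e: "e \<in> Out" "clear u v e" for u v w e
    proof -
      have eq: "V - {u, v, w, e} = insert d Out - {e}"
        using uvw e abcd by (auto simp: Out_def)
      have "near_clique (f a d) u v (V - {u, v, w, e})"
      proof (rule near_cliqueI[OF fin])
        show "distinct [u, v, w, e]" "{u, v, w, e} \<subseteq> V"
          using uvw e abcd by (auto simp: Out_def)
        show "f x y = f a d"
          if "x \<in> V - {u, v, w, e}" "y \<in> V - {u, v, w, e}" "x \<noteq> y" for x y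
          using that inner d unfolding eq by (metis Diff_iff insert_iff sym)
        show "f u x = f a d \<and> f v x = f a d" if "x \<in> V - {u, v, w, e}" for x
          using that e(2) unfolding eq clear_def by blast
      qed
      then show ?thesis by blast
    qed
    consider (a) e where "e \<in> Out" "f a e \<noteq> f a d" | (b) e where "e \<in> Out" "f b e \<noteq> f a d"
      | (c) e where "e \<in> Out" "f c e \<noteq> f a d"
      | (none) "\<And>x. x \<in> Out \<Longrightarrow> f a x = f a d \<and> f b x = f a d"
      by blast
    then show ?thesis
    proof cases
      case a
      have "f b x = f a d \<and> f b d = f a d \<and> f c x = f a d \<and> f c d = f a d" if "x \<in> Out" "x \<noteq> e" for x
        using paw_pendant_color(2)[OF paw, of e x] paw_pendant_color(2)[OF paw', of e x] d a that
        by (auto simp: Out_def)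
      then have "clear b c e"
        using other[of e] by (auto simp: clear_def)
      then show ?thesis
        using exchange[of b c a e] a abcd by auto
    next
      case b
      have "f a x = f a d \<and> f c x = f a d \<and> f c d = f a d" if "x \<in> Out" "x \<noteq> e" for x
        using paw_pendant_color(3)[OF paw, of e x] d b that by (auto simp: Out_def)
      then have "clear a c e"
        using other[of e] by (auto simp: clear_def)
      then show ?thesis
        using exchange[of a c b e] b abcd by auto
    next
      case c
      have "f a x = f a d \<and> f b x = f a d \<and> f b d = f a d" if "x \<in> Out" "x \<noteq> e" for x
        using paw_pendant_color(3)[OF paw', of e x] d c that by (auto simp: Out_def)
      then have "clear a b e"
        using other[of e] by (auto simp: clear_def)
      then show ?thesis
        using exchange[of a b c e] c abcd by auto
    next
      case none
      then have "near_clique (f a d) a b (V - {a, b, c, d})"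
        using abcd inner by (intro near_cliqueI[OF fin]) (auto simp: Out_def)
      then show ?thesis by blast
    qed
  qed
qed

section \<open>Rainbow chairs and pairs of cherries\<close>

text \<open>Without a rainbow paw or path, \<open>b d\<close> must have the color of
  \<open>a b\<close>, and \<open>b e\<close> that of \<open>a c\<close>; but then the triangle
  \<open>d b e\<close> with the edge \<open>d a\<close> is a rainbow paw.\<close>

lemma chair_imp_paw:
  assumes V: "distinct [a, b, c, d, e]" "{a, b, c, d, e} \<subseteq> V"
    and col: "distinct [f a b, f a c, f a d, f d e]"
  shows "\<exists>a b c d. paw a b c d"
proof (rule ccontr)
  assume "\<not> ?thesis"
  then have np: "\<not> paw a b c d" for a b c d
    by blast
  have S: "f b a = f a b" "f c a = f a c" "f c b = f b c" "f d a = f a d" "f d b = f b d"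
    "f d c = f c d" "f e a = f a e" "f e b = f b e" "f e c = f c e" "f e d = f d e"
    by (simp_all add: sym)
  show False
    using V col path[of c a d b e] path[of c a b e d] path[of b e d a c] path[of c a b d e]
      np[of d b e a] np[of d a b e] np[of a b d c]
    by (simp add: paw_def S) (smt (verit))
qed

text \<open>The cases are the ways in which the two cherries, with centers \<open>y\<close> and
  \<open>v\<close>, overlap: their union is a star, a paw, a chair, a 4-cycle, a path, or
  disconnected. Each leads to a rainbow paw or path.\<close>

lemma cherries_imp_paw:
  assumes fin: "finite V" and V: "5 \<le> card V"
    and xyz: "distinct [x, y, z]" "{x, y, z} \<subseteq> V"
    and uvw: "distinct [u, v, w]" "{u, v, w} \<subseteq> V"
    and col: "distinct [f x y, f y z, f u v, f v w]"
  shows "\<exists>a b c d. paw a b c d"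
proof (rule ccontr)
  assume neg: "\<not> ?thesis"
  then have np: "\<not> paw a b c d" for a b c d
    by blast
  have chair: "\<not> distinct [f a b, f a c, f a d, f d e]"
    if "distinct [a, b, c, d, e]" "{a, b, c, d, e} \<subseteq> V" for a b c d e
    using chair_imp_paw that neg by blast
  \<comment> \<open>The two chairs leave for \<open>b c\<close> only the colors of
    \<open>a d\<close> and \<open>a e\<close>; the other of these two edges then completes a rainbow
    paw.\<close>
  have star: "\<not> distinct [f a b, f a c, f a d, f a e]"
    if "distinct [a, b, c, d, e]" "{a, b, c, d, e} \<subseteq> V" for a b c d e
    using that chair[of a d e b c] chair[of a d e c b] np[of a b c e] np[of a b c d]
    by (simp add: paw_def sym[of c b]) metis
  \<comment> \<open>For a vertex \<open>e\<close> off the rainbow 4-cycle, the two paths ending in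
    \<open>b e\<close> leave for this edge only the colors of \<open>c d\<close> and
    \<open>a d\<close>; either gives a rainbow chair centered at \<open>b\<close>.\<close>
  have square: "\<not> distinct [f a b, f b c, f c d, f a d]"
    if abcd: "distinct [a, b, c, d]" "{a, b, c, d} \<subseteq> V" for a b c d
  proof -
    have "\<not> V \<subseteq> {a, b, c, d}"
      using V card_mono[of "{a, b, c, d}" V] card_length[of "[a, b, c, d]"] by auto
    then obtain e where "e \<in> V" "e \<notin> {a, b, c, d}"
      by blast
    moreover have "f d c = f c d" "f c b = f b c" "f b a = f a b" "f d a = f a d"
      by (simp_all add: sym)
    ultimately show ?thesis
      using abcd path[of a d c b e] path[of c d a b e] chair[of b a e c d] chair[of b c e a d]
      by (simp) (smt (verit))
  qed
  \<comment> \<open>The center of one cherry is an end of the other: a further common end closes a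
    rainbow paw, otherwise the union is a chair.\<close>
  have center_end: False if "distinct [x, y, z]" "{x, y, z} \<subseteq> V" "distinct [u, x, w]" "{u, x, w} \<subseteq> V"
    "distinct [f x y, f y z, f u x, f x w]" for x y z u w
  proof -
    have "u \<noteq> y" "w \<noteq> y"
      using that(5) sym by auto
    then show False
      using that np[of x y z w] np[of x y z u] chair[of x u w y z] sym[of z x] sym[of u x]
      by (cases "u = z"; cases "w = z") (auto simp: paw_def)
  qed
  consider "v = y" | "v = x" | "v = z" | "u = y" | "w = y"
    | (apart) "v \<notin> {x, y, z}" "y \<notin> {u, v, w}"
    by blast
  then show False
  proof cases
    case 1
    then have "u \<notin> {x, z}" "w \<notin> {x, z}"
      using col sym by auto
    then show False
      using 1 xyz uvw col star[of y x z u w] sym[of x y] sym[of u v] by auto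
  next
    case 2
    then show False
      using center_end[of x y z u w] xyz uvw col by auto
  next
    case 3
    then show False
      using center_end[of z y x u w] xyz uvw col sym[of z y] sym[of y x] by auto
  next
    case 4
    then show False
      using center_end[of y v w x z] xyz uvw col by auto
  next
    case 5
    then show False
      using center_end[of y v u x z] xyz uvw col sym[of y v] sym[of v u] by auto
  next
    case apart
    show False
    proof (cases "u \<in> {x, z} \<or> w \<in> {x, z}")
      case True
      then consider "u = x" "w = z" | "u = z" "w = x" | "u = x" "w \<noteq> z" | "u = z" "w \<noteq> x"
        | "w = x" "u \<noteq> z" | "w = z" "u \<noteq> x"
        using uvw by auto
      then show False
      proof cases
        case 1
        then show False
          using square[of x y z v] apart xyz uvw col sym[of w v] by auto
      next
        case 2
        then show False
          using square[of x y z v] apart xyz uvw col sym[of x v] sym[of z v] by auto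
      next
        case 3
        then show False
          using path[of z y x v w] apart xyz uvw col sym[of z y] sym[of y x] by auto
      next
        case 4
        then show False
          using path[of x y z v w] apart xyz uvw col by auto
      next
        case 5
        then show False
          using path[of z y x v u] apart xyz uvw col sym[of z y] sym[of y x] sym[of u v] sym[of v x]
          by auto
      next
        case 6
        then show False
          using path[of x y z v u] apart xyz uvw col sym[of u v] sym[of v z] by auto
      qed
    next
      case False
      \<comment> \<open>The edge \<open>y v\<close> joining the centers shares its color with at
        most one cherry edge, so it forms a rainbow chair with all of one cherry and a suitable edge
        of the other.\<close>
      have S: "f y x = f x y" "f v y = f y v" "f v u = f u v"
        by (simp_all add: sym)
      show False
        using False apart xyz uvw col chair[of y x z v u] chair[of y x z v w] chair[of v u w y x]
          chair[of v u w y z]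
        by (simp add: S) (smt (verit))
    qed
  qed
qed

section \<open>Dominating colors\<close>

text \<open>Equivalently, \<open>q\<close> belongs to every pair of distinct colors that meet at a
  vertex; the classes of the other colors are then vertex-disjoint.\<close>

definition dominating :: "'c \<Rightarrow> bool" where
  "dominating q \<longleftrightarrow> (\<forall>x\<in>V. \<forall>y\<in>V. \<forall>z\<in>V.
     x \<noteq> y \<longrightarrow> x \<noteq> z \<longrightarrow> f x y \<noteq> q \<longrightarrow> f x z \<noteq> q \<longrightarrow> f x y = f x z)"

text \<open>View the colors as vertices of a graph with edge relation \<open>adj\<close>. Two
  disjoint edges give a paw by \<open>cherries_imp_paw\<close>, and pairwise intersecting edges
  without a common vertex form a triangle \<open>A B C\<close>. A fourth color has a neighbour, and
  this edge is disjoint from a side of the triangle.\<close>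

lemma not_dominating_imp_paw:
  assumes fin: "finite V" and V: "5 \<le> card V"
    and col: "4 \<le> card {f x y | x y. x \<in> V \<and> y \<in> V \<and> x \<noteq> y}"
    and ndom: "\<And>q. \<not> dominating q"
  shows "\<exists>a b c d. paw a b c d"
proof (rule ccontr)
  assume neg: "\<not> ?thesis"
  define adj where "adj A B \<longleftrightarrow> A \<noteq> B \<and>
    (\<exists>x y z. distinct [x, y, z] \<and> {x, y, z} \<subseteq> V \<and> f x y = A \<and> f y z = B)" for A B
  have adj_sym: "adj B A" if "adj A B" for A B
  proof -
    obtain x y z where "distinct [x, y, z]" "{x, y, z} \<subseteq> V" "f x y = A" "f y z = B" "A \<noteq> B"
      using \<open>adj A B\<close> unfolding adj_def by blast
    then show ?thesis
      unfolding adj_def by (intro conjI exI[of _ z] exI[of _ y] exI[of _ x]) (auto simp: sym)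
  qed
  have meet: "\<not> distinct [A, B, C, D]" if "adj A B" "adj C D" for A B C D
  proof -
    obtain x y z where 1: "distinct [x, y, z]" "{x, y, z} \<subseteq> V" "f x y = A" "f y z = B"
      using \<open>adj A B\<close> unfolding adj_def by blast
    obtain u v w where 2: "distinct [u, v, w]" "{u, v, w} \<subseteq> V" "f u v = C" "f v w = D"
      using \<open>adj C D\<close> unfolding adj_def by blast
    show ?thesis
      using cherries_imp_paw[OF fin V 1(1,2) 2(1,2)] 1 2 neg by blast
  qed
  have avoid: "\<exists>A B. adj A B \<and> A \<noteq> q \<and> B \<noteq> q" for q
  proof -
    obtain x y z where *: "x \<in> V" "y \<in> V" "z \<in> V" "x \<noteq> y" "x \<noteq> z" "f x y \<noteq> q" "f x z \<noteq> q"
      "f x y \<noteq> f x z"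
      using ndom[of q] by (auto simp: dominating_def)
    then have "adj (f y x) (f x z)"
      using sym[of x y] unfolding adj_def by (intro conjI exI[of _ y] exI[of _ x] exI[of _ z]) auto
    then show ?thesis
      using * sym[of x y] by auto
  qed
  obtain A B where AB: "adj A B"
    using avoid by blast
  \<comment> \<open>An edge of the color graph avoiding \<open>A\<close> must meet
    \<open>A B\<close> in \<open>B\<close>; its other end is \<open>C\<close>.\<close>
  obtain C where BC: "adj B C" "C \<noteq> A"
  proof -
    obtain P Q where PQ: "adj P Q" "P \<noteq> A" "Q \<noteq> A"
      using avoid by blast
    moreover have "P \<noteq> Q" "A \<noteq> B"
      using AB PQ by (auto simp: adj_def)
    ultimately have "P = B \<or> Q = B"
      using meet[OF AB PQ(1)] by auto
    then show thesis
      using that PQ adj_sym by blast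
  qed
  have AC: "adj A C"
  proof -
    \<comment> \<open>An edge avoiding \<open>B\<close> must meet \<open>A B\<close> in
      \<open>A\<close> and \<open>B C\<close> in \<open>C\<close>.\<close>
    obtain P Q where PQ: "adj P Q" "P \<noteq> B" "Q \<noteq> B"
      using avoid by blast
    moreover have "P \<noteq> Q" "A \<noteq> B" "B \<noteq> C"
      using AB BC PQ by (auto simp: adj_def)
    ultimately have "P = A \<and> Q = C \<or> P = C \<and> Q = A"
      using meet[OF AB PQ(1)] meet[OF BC(1) PQ(1)] BC(2) by auto
    then show ?thesis
      using PQ adj_sym by blast
  qed
  have ne: "A \<noteq> B" "B \<noteq> C" "A \<noteq> C"
    using AB BC AC by (auto simp: adj_def)
  have "\<not> {f x y | x y. x \<in> V \<and> y \<in> V \<and> x \<noteq> y} \<subseteq> {A, B, C}"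
  proof
    assume "{f x y | x y. x \<in> V \<and> y \<in> V \<and> x \<noteq> y} \<subseteq> {A, B, C}"
    then have "card {f x y | x y. x \<in> V \<and> y \<in> V \<and> x \<noteq> y} \<le> card {A, B, C}"
      by (intro card_mono) simp
    also have "\<dots> \<le> 3"
      using card_length[of "[A, B, C]"] by simp
    finally show False
      using col by linarith
  qed
  then obtain u v where uv: "u \<in> V" "v \<in> V" "u \<noteq> v" "f u v \<notin> {A, B, C}"
    by blast
  obtain x y where xy: "x \<in> V" "y \<in> V" "x \<noteq> y" "f x y = A"
    using AB by (auto simp: adj_def)
  have adjI: "adj (f x y) (f y z)" if "distinct [x, y, z]" "{x, y, z} \<subseteq> V" "f x y \<noteq> f y z" for x y z
    using that unfolding adj_def by blast
  \<comment> \<open>An edge \<open>x y\<close> of color \<open>A\<close> either has \<open>x\<close>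
    on \<open>u v\<close> or is linked to it by \<open>x u\<close>, so the fourth color meets a
    different one somewhere.\<close>
  have "\<exists>Z. adj (f u v) Z"
  proof -
    have D: "f u v \<noteq> A" "f v u = f u v"
      using uv sym by auto
    consider "x = u" | "x = v" | "x \<notin> {u, v}" "f x u \<noteq> f u v" | "x \<notin> {u, v}" "f x u = f u v"
      by blast
    then show ?thesis
    proof cases
      case 1
      then have "y \<noteq> v"
        using xy D by auto
      then show ?thesis
        using adjI[of v u y] 1 uv xy D by auto
    next
      case 2
      then have "y \<noteq> u"
        using xy D by auto
      then show ?thesis
        using adjI[of u v y] 2 uv xy D by auto
    next
      case 3
      then show ?thesis
        using adjI[of v u x] sym[of u x] uv xy D by auto
    next
      case 4
      then have "y \<noteq> u"
        using xy D by auto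
      then show ?thesis
        using adjI[of u x y] sym[of u x] 4 uv xy D by auto
    qed
  qed
  then obtain Z where Z: "adj (f u v) Z"
    by blast
  then have "f u v \<noteq> Z"
    by (simp add: adj_def)
  then show False
    using uv ne meet[OF AB Z] meet[OF BC(1) Z] meet[OF AC Z] by auto
qed

text \<open>Five vertices leave no room for the spreading argument, but there a single vertex with
  two equally colored edges is already a near clique, and \<open>not_proper\<close> supplies
  it.\<close>

theorem dominating_or_near_clique:
  assumes fin: "finite V" and V: "5 \<le> card V"
    and col: "4 \<le> card {f x y | x y. x \<in> V \<and> y \<in> V \<and> x \<noteq> y}"
  shows "(\<exists>q. dominating q) \<or> (\<exists>q a b X. near_clique q a b X)"
proof (cases "card V = 5")
  case True
  then obtain xs where xs: "set xs = V" "distinct xs" "length xs = 5"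
    using fin by (metis distinct_card finite_distinct_list)
  then obtain a b c d e where "xs = [a, b, c, d, e]"
    by (auto simp: length_Suc_conv numeral_eq_Suc)
  then obtain x y z where xyz: "x \<in> V" "y \<in> V" "z \<in> V" "distinct [x, y, z]" "f x y = f x z"
    using xs not_proper[of a b c d e] by (auto simp del: distinct.simps)
  then have "near_clique (f x y) y z {x}"
    using True by (auto simp: near_clique_def)
  then show ?thesis
    by blast
next
  case False
  then have "6 \<le> card V"
    using V by simp
  then show ?thesis
    using paw_imp_near_clique[OF fin] not_dominating_imp_paw[OF fin V col] by blast
qed

end

section \<open>Monochromatic copies and arrow relations\<close>

lemma simple_graph_edgeE:
  assumes "simple_graph H" "e \<in> edges H"
  obtains u v where "e = {u, v}" "u \<in> verts H" "v \<in> verts H" "u \<noteq> v"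
proof -
  have "e \<in> nsets (verts H) 2"
    using assms by (auto simp: simple_graph_def)
  then show thesis
    using that by (auto simp: nsets_2_eq)
qed

lemma simple_graph_edgeD:
  assumes "simple_graph H" "{u, v} \<in> edges H"
  shows "u \<in> verts H" "v \<in> verts H" "u \<noteq> v"
proof -
  have "{u, v} \<in> nsets (verts H) 2"
    using assms unfolding simple_graph_def by blast
  then show "u \<in> verts H" "v \<in> verts H" "u \<noteq> v"
    by auto
qed

lemma embeds_complete_graphI:
  assumes "simple_graph H" "inj_on \<phi> (verts H)" "\<phi> ` verts H \<subseteq> {..<n}"
  shows "embeds \<phi> H (complete_graph n)"
proof -
  have "\<phi> ` e \<in> nsets {..<n} 2" if "e \<in> edges H" for e
  proof -
    obtain u v where "e = {u, v}" "u \<in> verts H" "v \<in> verts H" "u \<noteq> v"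
      using assms(1) \<open>e \<in> edges H\<close> by (rule simple_graph_edgeE)
    then show ?thesis
      using assms(2,3) by (auto simp: inj_on_def)
  qed
  then show ?thesis
    using assms by (simp add: embeds_def complete_graph_def)
qed

lemma has_monochromaticI:
  assumes "simple_graph H" "inj_on \<phi> (verts H)" "\<phi> ` verts H \<subseteq> {..<n}"
    and "\<And>u v. {u, v} \<in> edges H \<Longrightarrow> c {\<phi> u, \<phi> v} = a"
  shows "has_monochromatic (complete_graph n) c H"
  unfolding has_monochromatic_def
proof (intro exI conjI ballI)
  show "embeds \<phi> H (complete_graph n)"
    using assms embeds_complete_graphI by blast
  fix e assume "e \<in> edges H"
  then show "c (\<phi> ` e) = a"
    using assms(1,4) by (auto elim: simple_graph_edgeE)
qed

lemma has_monochromaticE: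
  assumes "has_monochromatic (complete_graph n) c H"
  obtains \<phi> a where "inj_on \<phi> (verts H)" "\<phi> ` verts H \<subseteq> {..<n}"
    and "\<And>u v. {u, v} \<in> edges H \<Longrightarrow> c {\<phi> u, \<phi> v} = a"
proof -
  obtain \<phi> a where "embeds \<phi> H (complete_graph n)" and a: "\<forall>e\<in>edges H. c (\<phi> ` e) = a"
    using assms by (auto simp: has_monochromatic_def)
  moreover have "c {\<phi> u, \<phi> v} = a" if "{u, v} \<in> edges H" for u v
    using bspec[OF a that] by simp
  ultimately show thesis
    using that by (auto simp: embeds_def complete_graph_def)
qed

lemma p5_free_if_no_rainbow:
  assumes "\<not> has_rainbow (complete_graph n) c (path_graph 5)"
  shows "p5_free {..<n} (\<lambda>x y. c {x, y})"
proof
  show "c {x, y} = c {y, x}" for x y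
    by (simp add: insert_commute)
  fix v w x y z
  assume V: "distinct [v, w, x, y, z]" "{v, w, x, y, z} \<subseteq> {..<n}"
  define \<phi> where "\<phi> i = [v, w, x, y, z] ! i" for i
  have \<phi>: "\<phi> 0 = v" "\<phi> 1 = w" "\<phi> 2 = x" "\<phi> 3 = y" "\<phi> 4 = z"
    by (simp_all add: \<phi>_def numeral_eq_Suc)
  have five: "{..<5} = {0, 1, 2, 3, 4 :: nat}"
    by auto
  have E: "edges (path_graph 5) = {{0, 1}, {1, 2}, {2, 3}, {3, 4}}"
  proof -
    have "{{i, Suc i} |i. Suc i < 5} = (\<lambda>i. {i, Suc i}) ` {0, 1, 2, 3}"
      by auto
    then show ?thesis
      by (simp add: path_graph_def numeral_eq_Suc)
  qed
  have "embeds \<phi> (path_graph 5) (complete_graph n)"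
    unfolding embeds_def E using V
    by (auto simp: path_graph_def complete_graph_def five \<phi> simp del: One_nat_def)
  then have "\<not> inj_on (\<lambda>e. c (\<phi> ` e)) {{0, 1}, {1, 2}, {2, 3}, {3, 4}}"
    using assms E by (auto simp: has_rainbow_def)
  then show "\<not> distinct [c {v, w}, c {w, x}, c {x, y}, c {y, z}]"
    by (rule contrapos_nn) (auto simp: inj_on_def \<phi> simp del: One_nat_def)
qed

section \<open>Arrow relations\<close>

text \<open>The property whose least \<open>n\<close> is \<open>ramsey_number k H\<close>, so that
  the argument can work with an arbitrary such \<open>n\<close>.\<close>

definition arrows :: "nat \<Rightarrow> nat \<Rightarrow> 'a sgraph \<Rightarrow> bool" where
  "arrows n k H \<longleftrightarrow> (\<forall>c. c ` nsets {..<n} 2 \<subseteq> {1..k} \<longrightarrow>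
     has_monochromatic (complete_graph n) c H)"

text \<open>Ramsey's theorem for cliques of the order of \<open>H\<close> provides some
  \<open>N\<close> with the property, so \<open>LEAST\<close> attains it.\<close>

lemma arrows_ramsey_number:
  assumes "simple_graph H"
  shows "arrows (ramsey_number k H) k H"
proof -
  define m where "m = card (verts H)"
  obtain N :: nat where N: "partn_lst {..<N} (replicate k m) 2"
    using ramsey_full by blast
  have "has_monochromatic (complete_graph N) c H" if c: "c ` nsets {..<N} 2 \<subseteq> {1..k}" for c
  proof -
    \<comment> \<open>\<open>partn_lst\<close> numbers the colors from 0, hence the shift by
      one.\<close>
    have "(\<lambda>e. c e - 1) \<in> nsets {..<N} 2 \<rightarrow> {..<k}"
    proof
      fix e assume "e \<in> nsets {..<N} 2"
      then have "c e \<in> {1..k}"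
        using c by blast
      then show "c e - 1 \<in> {..<k}" by auto
    qed
    then obtain i S where i: "i < k" and S: "S \<in> nsets {..<N} m"
      and mono: "(\<lambda>e. c e - 1) ` nsets S 2 \<subseteq> {i}"
      using N by (elim partn_lstE) auto
    have fin: "finite (verts H)"
      using assms by (simp add: simple_graph_def)
    have "finite S" "card (verts H) \<le> card S" "S \<subseteq> {..<N}"
      using S by (auto simp: nsets_def m_def)
    then obtain \<phi> where \<phi>: "inj_on \<phi> (verts H)" "\<phi> ` verts H \<subseteq> S"
      using card_le_inj[OF fin] by blast
    have "c {\<phi> u, \<phi> v} = Suc i" if "{u, v} \<in> edges H" for u v
    proof -
      have uv: "u \<in> verts H" "v \<in> verts H" "u \<noteq> v"
        using simple_graph_edgeD[OF assms that] by auto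
      then have e: "{\<phi> u, \<phi> v} \<in> nsets S 2"
        using \<phi> by (auto simp: inj_on_def)
      then have "{\<phi> u, \<phi> v} \<in> nsets {..<N} 2"
        using \<open>S \<subseteq> {..<N}\<close> by auto
      then have "c {\<phi> u, \<phi> v} \<in> {1..k}"
        using c by blast
      moreover have "c {\<phi> u, \<phi> v} - 1 = i"
        using mono e by blast
      ultimately show ?thesis by auto
    qed
    then show ?thesis
      using has_monochromaticI[OF assms \<phi>(1)] \<phi>(2) \<open>S \<subseteq> {..<N}\<close> by blast
  qed
  then have "\<exists>N. \<forall>c. c ` edges (complete_graph N) \<subseteq> {1..k} \<longrightarrow>
      has_monochromatic (complete_graph N) c H"
    by (auto simp: complete_graph_def)
  from LeastI_ex[OF this] show ?thesis
    by (simp add: arrows_def ramsey_number_def complete_graph_def)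
qed

text \<open>Renaming the used colors injectively into \<open>{1..k}\<close> keeps different colors
  different.\<close>

lemma few_colors_imp_monochromatic:
  assumes H: "simple_graph H" and arr: "arrows n k H" and few: "card (c ` nsets {..<n} 2) \<le> k"
  shows "has_monochromatic (complete_graph n) c H"
proof -
  have "finite (c ` nsets {..<n} 2)"
    by (simp add: finite_imp_finite_nsets)
  then obtain g where g: "g ` (c ` nsets {..<n} 2) \<subseteq> {1..k}" "inj_on g (c ` nsets {..<n} 2)"
    using card_le_inj[of "c ` nsets {..<n} 2" "{1..k}"] few by auto
  then have "has_monochromatic (complete_graph n) (g \<circ> c) H"
    using arr by (simp add: arrows_def image_comp)
  then obtain \<phi> a where emb: "embeds \<phi> H (complete_graph n)"
    and a: "\<And>e. e \<in> edges H \<Longrightarrow> g (c (\<phi> ` e)) = a"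
    by (auto simp: has_monochromatic_def)
  have "\<phi> ` e \<in> nsets {..<n} 2" if "e \<in> edges H" for e
    using emb that by (simp add: embeds_def complete_graph_def)
  then have "c (\<phi> ` e) = inv_into (c ` nsets {..<n} 2) g a" if "e \<in> edges H" for e
    using a[OF that] g(2) that by (metis image_eqI inv_into_f_f)
  then show ?thesis
    using emb by (auto simp: has_monochromatic_def)
qed

text \<open>A copy with at most one edge is monochromatic; the constant coloring shows that a copy
  fits at all.\<close>

lemma monochromatic_if_one_edge:
  assumes H: "simple_graph H" and arr: "arrows n k H" and "1 \<le> k"
    and one: "\<And>e e'. \<lbrakk>e \<in> edges H; e' \<in> edges H\<rbrakk> \<Longrightarrow> e = e'"
  shows "has_monochromatic (complete_graph n) c H"
proof -
  have "has_monochromatic (complete_graph n) (\<lambda>_. 1) H"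
    using arr \<open>1 \<le> k\<close> unfolding arrows_def by (elim allE[of _ "\<lambda>_. 1"]) auto
  then obtain \<phi> where "embeds \<phi> H (complete_graph n)"
    by (auto simp: has_monochromatic_def)
  moreover have "\<exists>a. \<forall>e\<in>edges H. c (\<phi> ` e) = a"
    using one by metis
  ultimately show ?thesis
    by (auto simp: has_monochromatic_def)
qed

text \<open>Propagation along walks: a set closed under the edges of a color contains a connected
  copy in that color once it contains one of its vertices.\<close>

lemma connected_image_subset:
  assumes "connected_graph G" "u \<in> verts G" "\<phi> u \<in> B"
    and closed: "\<And>v w. \<lbrakk>{v, w} \<in> edges G; \<phi> v \<in> B\<rbrakk> \<Longrightarrow> \<phi> w \<in> B"
  shows "\<phi> ` verts G \<subseteq> B"
proof clarify
  fix v assume "v \<in> verts G"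
  then have "(u, v) \<in> {(x, y). {x, y} \<in> edges G}\<^sup>*"
    using assms by (simp add: connected_graph_def)
  then show "\<phi> v \<in> B"
    by induction (use assms(3) closed in auto)
qed

lemma connected_graph_neighbour:
  assumes "connected_graph G" "2 \<le> card (verts G)" "v \<in> verts G"
  obtains w where "{v, w} \<in> edges G"
proof -
  have "\<not> verts G \<subseteq> {v}"
    using assms(2) card_mono[of "{v}" "verts G"] by auto
  then obtain u where "u \<in> verts G" "u \<noteq> v"
    by blast
  then have "(v, u) \<in> {(x, y). {x, y} \<in> edges G}\<^sup>*"
    using assms by (simp add: connected_graph_def)
  then show thesis
    by (cases rule: converse_rtranclE) (use that \<open>u \<noteq> v\<close> in auto)
qed

lemma monochromatic_if_near_clique:
  assumes H: "simple_graph H" and T: "T \<subseteq> verts H" "card T \<le> 2"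
    and indep: "\<And>u v. \<lbrakk>u \<in> T; v \<in> T\<rbrakk> \<Longrightarrow> {u, v} \<notin> edges H"
    and card: "card (verts H) \<le> card X + card T"
    and ab: "a < n" "b < n" "a \<noteq> b" and X: "X \<subseteq> {..<n} - {a, b}"
    and q: "\<And>x y. \<lbrakk>x \<in> X; y \<in> X \<union> {a, b}; x \<noteq> y\<rbrakk> \<Longrightarrow> c {x, y} = q"
  shows "has_monochromatic (complete_graph n) c H"
proof -
  have fin: "finite (verts H)" "finite T" "finite X"
    using H finite_subset[OF T(1)] finite_subset[OF X] by (auto simp: simple_graph_def)
  have "card (verts H - T) \<le> card X"
    using card T fin by (simp add: card_Diff_subset)
  then obtain g where g: "g ` (verts H - T) \<subseteq> X" "inj_on g (verts H - T)"
    using card_le_inj[of "verts H - T" X] fin by auto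
  obtain h where h: "h ` T \<subseteq> {a, b}" "inj_on h T"
    using card_le_inj[of T "{a, b}"] fin T ab by auto
  define \<phi> where "\<phi> v = (if v \<in> T then h v else g v)" for v
  have 1: "\<phi> v \<in> {a, b}" if "v \<in> T" for v
    using h that by (auto simp: \<phi>_def)
  have 2: "\<phi> v \<in> X" if "v \<in> verts H" "v \<notin> T" for v
    using g that by (auto simp: \<phi>_def)
  have inj: "inj_on \<phi> (verts H)"
  proof (rule inj_onI)
    fix u v assume uv: "u \<in> verts H" "v \<in> verts H" "\<phi> u = \<phi> v"
    then have "u \<in> T \<longleftrightarrow> v \<in> T"
      using 1 2 X by (metis Diff_iff subsetD)
    then show "u = v"
      using uv g(2) h(2) by (auto simp: \<phi>_def inj_on_def split: if_splits)
  qed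
  have "\<phi> v \<in> {..<n}" if "v \<in> verts H" for v
    using 1[of v] 2[OF that] X ab by (cases "v \<in> T") auto
  moreover have "c {\<phi> u, \<phi> v} = q" if e: "{u, v} \<in> edges H" for u v
  proof -
    have uv: "u \<in> verts H" "v \<in> verts H" "\<phi> u \<noteq> \<phi> v"
      using simple_graph_edgeD[OF H e] inj by (auto simp: inj_on_def)
    consider "u \<notin> T" | "v \<notin> T"
      using indep e by blast
    then show ?thesis
    proof cases
      case 1
      then show ?thesis
        using uv 2[of u] 2[of v] \<open>\<And>v. v \<in> T \<Longrightarrow> \<phi> v \<in> {a, b}\<close>[of v] q[of "\<phi> u" "\<phi> v"] by auto
    next
      case 2
      then have "c {\<phi> v, \<phi> u} = q"
        using uv \<open>\<And>v. \<lbrakk>v \<in> verts H; v \<notin> T\<rbrakk> \<Longrightarrow> \<phi> v \<in> X\<close> 1[of u] q[of "\<phi> v" "\<phi> u"] by (metis UnI1 UnI2)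
      then show ?thesis by (simp add: insert_commute)
    qed
  qed
  ultimately show ?thesis
    using has_monochromaticI[OF H inj] by blast
qed

text \<open>Color a 5-cycle with one color and all other edges with another: no three vertices of the cycle
  span a monochromatic triangle.\<close>

lemma arrows_complete_lower_bound:
  assumes H: "simple_graph H" and m: "3 \<le> card (verts H)" and k: "2 \<le> k" and arr: "arrows n k H"
    and compl: "\<And>u v. \<lbrakk>u \<in> verts H; v \<in> verts H; u \<noteq> v\<rbrakk> \<Longrightarrow> {u, v} \<in> edges H"
  shows "card (verts H) + 3 \<le> n"
proof (rule ccontr)
  assume n: "\<not> ?thesis"
  \<comment> \<open>Within \<open>{..4}\<close> the differences 1 and 4 are the edges of the
    5-cycle.\<close>
  define c :: "nat set \<Rightarrow> nat" where
    "c e = (if e \<subseteq> {..4} \<and> Max e - Min e \<in> {1, 4} then 2 else 1)" for e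
  have "c ` nsets {..<n} 2 \<subseteq> {1..k}"
    using k by (auto simp: c_def)
  then have "has_monochromatic (complete_graph n) c H"
    using arr by (simp add: arrows_def)
  then obtain \<phi> a where \<phi>: "inj_on \<phi> (verts H)" "\<phi> ` verts H \<subseteq> {..<n}"
    and a: "\<And>u v. {u, v} \<in> edges H \<Longrightarrow> c {\<phi> u, \<phi> v} = a"
    by (rule has_monochromaticE) (rule that)
  define I where "I = \<phi> ` verts H"
  have "finite I" "card I = card (verts H)"
    using H \<phi> by (auto simp: I_def simple_graph_def card_image)
  \<comment> \<open>As \<open>n\<close> is at most \<open>card (verts H) + 2\<close>, at most
    \<open>card (verts H) - 3\<close> vertices lie off the cycle, so the copy has three on
    it.\<close>
  have "I - {..4} \<subseteq> {5..<card (verts H) + 2}"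
    using \<phi>(2) n by (force simp: I_def)
  then have "card (I - {..4}) \<le> card (verts H) - 3"
    using card_mono[of "{5..<card (verts H) + 2}"] by fastforce
  moreover have "card I = card (I \<inter> {..4}) + card (I - {..4})"
    using \<open>finite I\<close> card_Int_Diff by blast
  ultimately have "3 \<le> card (I \<inter> {..4})"
    using m \<open>card I = card (verts H)\<close> by linarith
  then obtain A where "A \<subseteq> I \<inter> {..4}" "card A = 3"
    using obtain_subset_with_card_n by metis
  then obtain x y z where xyz: "x \<in> I" "y \<in> I" "z \<in> I" "x \<le> 4" "y \<le> 4" "z \<le> 4"
      "x \<noteq> y" "x \<noteq> z" "y \<noteq> z"
    by (auto simp: card_3_iff)
  have col: "c {x, y} = a" if "x \<in> I" "y \<in> I" "x \<noteq> y" for x y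
    using that compl a by (auto simp: I_def)
  have cyc: "c {x, y} = (if y = x + 1 \<or> x = y + 1 \<or> y = x + 4 \<or> x = y + 4 then 2 else 1)"
    if "x \<le> 4" "y \<le> 4" for x y
    using that by (auto simp: c_def max_def min_def)
  have "c {x, y} = c {y, z}" "c {x, y} = c {x, z}"
    using col xyz by auto
  note eq = this[unfolded cyc[OF xyz(4,5)] cyc[OF xyz(4,6)] cyc[OF xyz(5,6)]]
  have "x \<in> {0, 1, 2, 3, 4}" "y \<in> {0, 1, 2, 3, 4}" "z \<in> {0, 1, 2, 3, 4}"
    using xyz(4-6) by auto
  then show False
    using xyz(7-9) eq by (elim insertE emptyE) simp_all
qed

section \<open>Disjoint unions of homological graphs\<close>

lemma add_mod_inj:
  fixes i i' j k :: nat
  assumes "i \<in> {1..k}" "i' \<in> {1..k}" "(i + j) mod k = (i' + j) mod k"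
  shows "i = i'"
proof -
  have le: "a = b" if "a \<le> b" "a \<in> {1..k}" "b \<in> {1..k}" "(a + j) mod k = (b + j) mod k" for a b
  proof -
    have "k dvd b - a"
      using that mod_eq_dvd_iff_nat[of "a + j" "b + j" k] by simp
    moreover have "b - a < k"
      using that by auto
    ultimately show ?thesis
      using \<open>a \<le> b\<close> nat_dvd_not_less[of "b - a" k] by linarith
  qed
  show ?thesis
  proof (cases "i \<le> i'")
    case True
    then show ?thesis
      using le assms by blast
  next
    case False
    then show ?thesis
      using le[of i' i] assms by simp
  qed
qed

text \<open>The bounds on \<open>k\<close> have separate roles: \<open>t \<le> k\<close> and
  \<open>p \<le> k\<close> make the cyclic assignment of color classes to parts injective, and
  \<open>3 \<le> k\<close> admits the lower-bound colorings and settles colorings with at most three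
  colors.\<close>

locale homological_graphs =
  fixes G :: "nat \<Rightarrow> 'a sgraph" and t p k N :: nat
    and s :: "nat \<Rightarrow> nat" and col :: "nat \<Rightarrow> 'a \<Rightarrow> nat"
  assumes t: "1 \<le> t" "t \<le> k" and p: "p \<le> k" and k: "3 \<le> k"
    and simple: "\<And>i. i \<in> {1..t} \<Longrightarrow> simple_graph (G i)"
    and connected: "\<And>i. i \<in> {1..t} \<Longrightarrow> connected_graph (G i)"
    and card_verts: "\<And>i. i \<in> {1..t} \<Longrightarrow> card (verts (G i)) = N"
    and col: "\<And>i. i \<in> {1..t} \<Longrightarrow> proper_vertex_coloring (G i) p (col i)"
    and class_size: "\<And>i j. \<lbrakk>i \<in> {1..t}; j \<in> {1..p}\<rbrakk> \<Longrightarrow> card {v \<in> verts (G i). col i v = j} = s j"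
begin

abbreviation "H \<equiv> disjoint_union t G"

lemma mem_verts_H: "(i, v) \<in> verts H \<longleftrightarrow> i \<in> {1..t} \<and> v \<in> verts (G i)"
  by (auto simp: disjoint_union_def)

lemma finite_verts: "i \<in> {1..t} \<Longrightarrow> finite (verts (G i))"
  using simple by (simp add: simple_graph_def)

lemma edge_H:
  assumes "i \<in> {1..t}" "{u, v} \<in> edges (G i)"
  shows "{(i, u), (i, v)} \<in> edges H"
proof -
  have "Pair i ` {u, v} \<in> (\<Union>i\<in>{1..t}. (\<lambda>e. Pair i ` e) ` edges (G i))"
    by (intro UN_I[OF assms(1)] imageI assms(2))
  then show ?thesis
    by (simp add: disjoint_union_def)
qed

lemma edge_HE:
  assumes "e \<in> edges H"
  obtains i u v where "i \<in> {1..t}" "{u, v} \<in> edges (G i)" "e = {(i, u), (i, v)}"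
proof -
  obtain i e' where i: "i \<in> {1..t}" "e' \<in> edges (G i)" "e = Pair i ` e'"
    using assms by (auto simp: disjoint_union_def)
  obtain u v where "e' = {u, v}"
    using simple_graph_edgeE[OF simple[OF i(1)] i(2)] by metis
  then show thesis
    using i that by auto
qed

lemma simple_H: "simple_graph H"
proof -
  have "e \<in> nsets (verts H) 2" if "e \<in> edges H" for e
    using that
  proof (rule edge_HE)
    fix i u v assume "i \<in> {1..t}" "{u, v} \<in> edges (G i)" "e = {(i, u), (i, v)}"
    then show ?thesis
      using simple_graph_edgeD[OF simple, of i u v] by (simp add: mem_verts_H)
  qed
  moreover have "finite (verts H)"
    using finite_verts by (auto simp: disjoint_union_def)
  ultimately show ?thesis
    by (auto simp: simple_graph_def)
qed

lemma card_H: "card (verts H) = t * N"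
  using finite_verts card_verts by (simp add: disjoint_union_def card_SigmaI)

section \<open>Lower bounds on the number of vertices\<close>

lemma edge_at:
  assumes "i \<in> {1..t}" "v \<in> verts (G i)" and N: "2 \<le> N"
  obtains w where "{v, w} \<in> edges (G i)"
proof -
  have "2 \<le> card (verts (G i))"
    using card_verts[OF assms(1)] N by simp
  then show thesis
    using connected_graph_neighbour[OF connected[OF assms(1)] _ assms(2)] that by blast
qed

lemma edge_in:
  assumes i: "i \<in> {1..t}" and N: "2 \<le> N"
  obtains u v where "{u, v} \<in> edges (G i)"
proof -
  obtain u where "u \<in> verts (G i)"
    using connected[OF i] unfolding connected_graph_def by blast
  then show thesis
    using edge_at[OF i _ N] that by blast
qed

lemma component_image:
  assumes "inj_on \<phi> (verts H)" "i \<in> {1..t}"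
  shows "card ((\<lambda>v. \<phi> (i, v)) ` verts (G i)) = N"
proof -
  have "inj_on (\<lambda>v. \<phi> (i, v)) (verts (G i))"
    using inj_onD[OF assms(1)] assms(2) by (intro inj_onI) (metis Pair_inject mem_verts_H)
  from card_image[OF this] show ?thesis
    by (simp add: card_verts[OF assms(2)])
qed

text \<open>Color so that every color splits \<open>{0..N}\<close> into a pair and a set of size \<open>N - 1\<close> with no edge of
  that color between them.\<close>

lemma lower_bound_connected:
  assumes arr: "arrows n k H" and "t = 1" and N3: "3 \<le> N"
  shows "N + 2 \<le> n"
proof (rule ccontr)
  assume n: "\<not> ?thesis"
  define c :: "nat set \<Rightarrow> nat" where
    "c e = (if e \<subseteq> {2..} \<or> e = {0, 1} then 1
            else if e = {0, 2} \<or> 1 \<in> e \<and> e \<noteq> {1, 2} then 2 else 3)" for e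
  have "c ` nsets {..<n} 2 \<subseteq> {1..k}"
    using k by (auto simp: c_def)
  then have "has_monochromatic (complete_graph n) c H"
    using arr by (simp add: arrows_def)
  then obtain \<phi> a where \<phi>: "inj_on \<phi> (verts H)" "\<phi> ` verts H \<subseteq> {..<n}"
    and a: "\<And>u v. {u, v} \<in> edges H \<Longrightarrow> c {\<phi> u, \<phi> v} = a"
    by (rule has_monochromaticE) (rule that)
  \<comment> \<open>The pair that color \<open>a\<close> separates from the rest: the copy fits
    neither into its 2 vertices nor into the other \<open>N - 1\<close>.\<close>
  define B :: "nat set" where "B = (if a = 1 then {0, 1} else if a = 2 then {0, 2} else {1, 2})"
  have B: "finite B" "card B = 2" "B \<subseteq> {..N}"
    using N3 by (auto simp: B_def)
  have closed: "y \<in> B" if "c {x, y} = a" "x \<in> B" for x y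
    using that by (auto simp: B_def c_def doubleton_eq_iff split: if_splits)
  have 1: "1 \<in> {1..t}"
    using t by simp
  define \<psi> where "\<psi> v = \<phi> (1, v)" for v
  have card: "card (\<psi> ` verts (G 1)) = N"
    using component_image[OF \<phi>(1) 1] by (simp add: \<psi>_def)
  have col: "c {\<psi> u, \<psi> v} = a" if "{u, v} \<in> edges (G 1)" for u v
    using a[OF edge_H[OF 1 that]] by (simp add: \<psi>_def)
  show False
  proof (cases "\<exists>u\<in>verts (G 1). \<psi> u \<in> B")
    case True
    then have "\<psi> ` verts (G 1) \<subseteq> B"
      using connected_image_subset[OF connected[OF 1], of _ \<psi> B] closed col by blast
    from card_mono[OF B(1) this] show False
      using B(2) card N3 by simp
  next
    case False
    moreover have "\<psi> v \<le> N" if "v \<in> verts (G 1)" for v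
    proof -
      have "\<phi> (1, v) \<in> {..<n}"
        using \<phi>(2) 1 that by (meson image_subset_iff mem_verts_H)
      then show ?thesis
        using n by (simp add: \<psi>_def)
    qed
    ultimately have "\<psi> ` verts (G 1) \<subseteq> {..N} - B"
      by auto
    moreover have "card ({..N} - B) = N - 1"
      using B by (simp add: card_Diff_subset)
    ultimately show False
      using card_mono[of "{..N} - B" "\<psi> ` verts (G 1)"] card N3 by simp
  qed
qed

text \<open>On \<open>t * N + 1\<close> vertices let two colors be stars at 0 and 1. The third color
  covers only \<open>t * N - 1\<close> vertices, while no vertex of \<open>H\<close> is isolated; a
  star lacks the two disjoint edges that two components provide.\<close>

lemma lower_bound_disconnected:
  assumes arr: "arrows n k H" and "2 \<le> t" and N: "2 \<le> N"
  shows "t * N + 2 \<le> n"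
proof (rule ccontr)
  assume n: "\<not> ?thesis"
  define c :: "nat set \<Rightarrow> nat" where "c e = (if 0 \<in> e then 2 else if 1 \<in> e then 3 else 1)" for e
  have c1: "0 \<notin> e \<and> 1 \<notin> e" if "c e = 1" for e
    using that by (cases "0 \<in> e"; cases "1 \<in> e") (auto simp: c_def)
  have c23: "0 \<in> e \<and> 0 \<in> e' \<or> 1 \<in> e \<and> 1 \<in> e'" if "c e \<noteq> 1" "c e = c e'" for e e'
    using that by (cases "0 \<in> e"; cases "1 \<in> e"; cases "0 \<in> e'"; cases "1 \<in> e'") (auto simp: c_def)
  have "c ` nsets {..<n} 2 \<subseteq> {1..k}"
    using k by (auto simp: c_def)
  then have "has_monochromatic (complete_graph n) c H"
    using arr by (simp add: arrows_def)
  then obtain \<phi> a where \<phi>: "inj_on \<phi> (verts H)" "\<phi> ` verts H \<subseteq> {..<n}"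
    and a: "\<And>u v. {u, v} \<in> edges H \<Longrightarrow> c {\<phi> u, \<phi> v} = a"
    by (rule has_monochromaticE) (rule that)
  have comp: "1 \<in> {1..t}" "2 \<in> {1..t}"
    using \<open>2 \<le> t\<close> by auto
  obtain u v where uv: "{u, v} \<in> edges (G 1)"
    using edge_in[OF comp(1) N] by blast
  obtain u' v' where uv': "{u', v'} \<in> edges (G 2)"
    using edge_in[OF comp(2) N] by blast
  have disj: "{\<phi> (1, u), \<phi> (1, v)} \<inter> {\<phi> (2, u'), \<phi> (2, v')} = {}"
    using \<phi>(1) comp simple_graph_edgeD[OF simple[OF comp(1)] uv]
      simple_graph_edgeD[OF simple[OF comp(2)] uv']
    by (auto dest!: inj_onD simp: mem_verts_H)
  show False
  proof (cases "a = 1")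
    case True
    have "\<phi> x \<in> {2..<t * N + 1}" if x: "x \<in> verts H" for x
    proof -
      obtain i v where v: "x = (i, v)" "i \<in> {1..t}" "v \<in> verts (G i)"
        using x by (cases x) (auto simp: mem_verts_H)
      obtain w where "{v, w} \<in> edges (G i)"
        using edge_at v N by blast
      then have "c {\<phi> (i, v), \<phi> (i, w)} = 1"
        using a edge_H v True by blast
      from c1[OF this] have "\<phi> (i, v) \<noteq> 0" "\<phi> (i, v) \<noteq> 1"
        by auto
      moreover have "\<phi> x \<in> {..<n}"
        using \<phi>(2) x by blast
      ultimately show ?thesis
        using n v(1) by simp
    qed
    then have "card (\<phi> ` verts H) \<le> card {2..<t * N + 1}"
      by (intro card_mono) auto
    moreover have "card {2..<t * N + 1} = t * N - 1" "t * N \<noteq> 0"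
      using t N by auto
    ultimately show False
      using card_image[OF \<phi>(1)] card_H by linarith
  next
    case False
    moreover have "c {\<phi> (1, u), \<phi> (1, v)} = a" "c {\<phi> (2, u'), \<phi> (2, v')} = a"
      using a edge_H comp uv uv' by blast+
    ultimately show False
      using disj c23[of "{\<phi> (1, u), \<phi> (1, v)}" "{\<phi> (2, u'), \<phi> (2, v')}"] by auto
  qed
qed

lemma lower_bound:
  assumes "arrows n k H" "3 \<le> t * N" "2 \<le> N"
  shows "t * N + 2 \<le> n"
proof (cases "t = 1")
  case True
  then show ?thesis
    using lower_bound_connected assms by simp
next
  case False
  then show ?thesis
    using lower_bound_disconnected assms t by simp
qed

section \<open>Cyclic distribution of the color classes\<close>

lemma sum_class_sizes: "(\<Sum>j\<in>{1..p}. s j) = N"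
proof -
  have 1: "1 \<in> {1..t}"
    using t by simp
  have "verts (G 1) = (\<Union>j\<in>{1..p}. {v \<in> verts (G 1). col 1 v = j})"
    using col[OF 1] by (auto simp: proper_vertex_coloring_def)
  then have "card (verts (G 1)) = card (\<Union>j\<in>{1..p}. {v \<in> verts (G 1). col 1 v = j})"
    by simp
  also have "\<dots> = (\<Sum>j\<in>{1..p}. card {v \<in> verts (G 1). col 1 v = j})"
    using finite_verts[OF 1] by (intro card_UN_disjoint) auto
  also have "\<dots> = (\<Sum>j\<in>{1..p}. s j)"
    using class_size[OF 1] by simp
  finally show ?thesis
    using card_verts[OF 1] by simp
qed

text \<open>Color class \<open>j\<close> of component \<open>i\<close> goes to part \<open>i + j\<close> modulo \<open>k\<close>. As in a Latin square, a part
  receives each \<open>j\<close> from at most one component, hence at most \<open>s 1 + \<dots> + s p = N\<close> vertices.\<close>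

definition part :: "nat \<times> 'a \<Rightarrow> nat" where
  "part x = (fst x + col (fst x) (snd x)) mod k"

lemma card_part_le: "card {x \<in> verts H. part x = l} \<le> N"
proof -
  define W where "W j = {x \<in> verts H. part x = l \<and> col (fst x) (snd x) = j}" for j
  have fin: "finite (verts H)"
    using simple_H by (simp add: simple_graph_def)
  have W: "card (W j) \<le> s j" if j: "j \<in> {1..p}" for j
  proof (cases "W j = {}")
    case False
    then obtain i v where iv: "(i, v) \<in> W j"
      by auto
    then have i: "i \<in> {1..t}" "(i + j) mod k = l"
      by (auto simp: W_def mem_verts_H part_def)
    have "W j \<subseteq> Pair i ` {v \<in> verts (G i). col i v = j}"
    proof
      fix x assume x: "x \<in> W j"
      obtain i' v' where x': "x = (i', v')"
        by (cases x)
      then have i': "i' \<in> {1..t}" "(i' + j) mod k = l" "v' \<in> verts (G i')" "col i' v' = j"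
        using x by (auto simp: W_def mem_verts_H part_def)
      then have "i' = i"
        using add_mod_inj[of i' k i j] i t by simp
      then show "x \<in> Pair i ` {v \<in> verts (G i). col i v = j}"
        using x' i' by auto
    qed
    then have "card (W j) \<le> card (Pair i ` {v \<in> verts (G i). col i v = j})"
      using finite_verts[OF i(1)] by (intro card_mono) auto
    also have "\<dots> \<le> card {v \<in> verts (G i). col i v = j}"
      using finite_verts[OF i(1)] by (intro card_image_le) auto
    also have "\<dots> = s j"
      using class_size i(1) j by blast
    finally show ?thesis .
  qed simp
  have "{x \<in> verts H. part x = l} \<subseteq> (\<Union>j\<in>{1..p}. W j)"
    using col by (fastforce simp: W_def proper_vertex_coloring_def mem_verts_H)
  then have "card {x \<in> verts H. part x = l} \<le> card (\<Union>j\<in>{1..p}. W j)"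
    using fin by (intro card_mono) (auto simp: W_def)
  also have "\<dots> \<le> (\<Sum>j\<in>{1..p}. card (W j))"
    by (rule card_UN_le) simp
  also have "\<dots> \<le> (\<Sum>j\<in>{1..p}. s j)"
    using W by (rule sum_mono)
  finally show ?thesis
    using sum_class_sizes by simp
qed

text \<open>For fixed \<open>i\<close> the class numbers, at most \<open>p \<le> k\<close>, have
  different residues modulo \<open>k\<close>.\<close>

lemma part_neq:
  assumes "i \<in> {1..t}" "{u, v} \<in> edges (G i)"
  shows "part (i, u) \<noteq> part (i, v)"
proof
  have uv: "u \<in> verts (G i)" "v \<in> verts (G i)"
    using simple_graph_edgeD[OF simple[OF assms(1)] assms(2)] by auto
  then have c: "col i u \<in> {1..p}" "col i v \<in> {1..p}" "col i u \<noteq> col i v"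
    using col[OF assms(1)] assms(2) by (auto simp: proper_vertex_coloring_def)
  assume "part (i, u) = part (i, v)"
  then have "(col i u + i) mod k = (col i v + i) mod k"
    by (simp add: part_def add.commute)
  then show False
    using add_mod_inj[of "col i u" k "col i v" i] c p by simp
qed

text \<open>Each part has at most \<open>N\<close> vertices and injects into its own
  \<open>P l\<close>; edges of \<open>H\<close> join different parts, so their images have color
  \<open>q\<close>.\<close>

lemma monochromatic_if_many_parts:
  assumes fin: "\<And>l. l < k \<Longrightarrow> finite (P l)" and big: "\<And>l. l < k \<Longrightarrow> N \<le> card (P l)"
    and sub: "\<And>l. l < k \<Longrightarrow> P l \<subseteq> {..<n}"
    and disj: "\<And>l l'. \<lbrakk>l < k; l' < k; l \<noteq> l'\<rbrakk> \<Longrightarrow> P l \<inter> P l' = {}"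
    and q: "\<And>l l' x y. \<lbrakk>l < k; l' < k; l \<noteq> l'; x \<in> P l; y \<in> P l'\<rbrakk> \<Longrightarrow> c {x, y} = q"
  shows "has_monochromatic (complete_graph n) c H"
proof -
  have part: "part x < k" for x
    using k by (simp add: part_def)
  have "\<forall>l\<in>{..<k}. \<exists>g. g ` {x \<in> verts H. part x = l} \<subseteq> P l \<and> inj_on g {x \<in> verts H. part x = l}"
  proof (intro ballI card_le_inj)
    fix l assume "l \<in> {..<k}"
    then have "l < k" by simp
    show "finite {x \<in> verts H. part x = l}"
      using simple_H by (simp add: simple_graph_def)
    show "card {x \<in> verts H. part x = l} \<le> card (P l)"
      using card_part_le big[OF \<open>l < k\<close>] le_trans by blast
    show "finite (P l)"
      using fin \<open>l < k\<close> .
  qed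
  from bchoice[OF this] obtain g where g: "\<And>l. l < k \<Longrightarrow> g l ` {x \<in> verts H. part x = l} \<subseteq> P l"
    "\<And>l. l < k \<Longrightarrow> inj_on (g l) {x \<in> verts H. part x = l}"
    by auto
  define \<phi> where "\<phi> x = g (part x) x" for x
  have \<phi>: "\<phi> x \<in> P (part x)" if "x \<in> verts H" for x
    using g(1)[OF part, of x] that by (auto simp: \<phi>_def)
  have inj: "inj_on \<phi> (verts H)"
  proof (rule inj_onI)
    fix x y assume xy: "x \<in> verts H" "y \<in> verts H" "\<phi> x = \<phi> y"
    then have eq: "part x = part y"
      using \<phi> disj[OF part part] by (metis disjoint_iff)
    then show "x = y"
      using inj_onD[OF g(2)[OF part, of x], of x y] xy by (simp add: \<phi>_def)
  qed
  show ?thesis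
  proof (rule has_monochromaticI[OF simple_H inj])
    show "\<phi> ` verts H \<subseteq> {..<n}"
      using \<phi> sub[OF part] by blast
    fix x y assume "{x, y} \<in> edges H"
    then obtain i u v where i: "i \<in> {1..t}" "{u, v} \<in> edges (G i)" "{x, y} = {(i, u), (i, v)}"
      by (rule edge_HE)
    then have "part x \<noteq> part y"
      using part_neq[OF i(1,2)] by (auto simp: doubleton_eq_iff)
    moreover have "x \<in> verts H" "y \<in> verts H"
      using simple_graph_edgeD[OF simple_H \<open>{x, y} \<in> edges H\<close>] by auto
    ultimately show "c {\<phi> x, \<phi> y} = q"
      using q[OF part part] \<phi> by blast
  qed
qed

section \<open>Colorings with a dominating color\<close>

text \<open>The sets \<open>U j\<close> of vertices meeting color \<open>j\<close> are disjoint for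
  \<open>j\<close> other than \<open>q\<close>, with only \<open>q\<close> between them. With
  \<open>k\<close> sets of size at least \<open>N\<close> the parts of \<open>H\<close> fit in; with
  fewer, \<open>k\<close> colors suffice to keep \<open>q\<close> and all large classes
  apart.\<close>

lemma monochromatic_if_dominating:
  assumes arr: "arrows n k H"
    and dom: "\<And>x y z. \<lbrakk>x < n; y < n; z < n; x \<noteq> y; x \<noteq> z; c {x, y} \<noteq> q; c {x, z} \<noteq> q\<rbrakk>
      \<Longrightarrow> c {x, y} = c {x, z}"
  shows "has_monochromatic (complete_graph n) c H"
proof -
  define U where "U j = {x. x < n \<and> (\<exists>y<n. x \<noteq> y \<and> c {x, y} = j)}" for j
  have fin_U: "finite (U j)" for j
    by (simp add: U_def)
  have disj_U: "i = j" if "i \<noteq> q" "j \<noteq> q" "x \<in> U i" "x \<in> U j" for i j x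
    using that dom unfolding U_def by blast
  define big where "big = {j \<in> c ` nsets {..<n} 2. j \<noteq> q \<and> N \<le> card (U j)}"
  have fin_big: "finite big"
    by (simp add: big_def finite_imp_finite_nsets)
  show ?thesis
  proof (cases "k \<le> card big")
    case True
    then obtain \<beta> where \<beta>: "\<beta> ` {..<k} \<subseteq> big" "inj_on \<beta> {..<k}"
      using card_le_inj[of "{..<k}" big] fin_big by auto
    show ?thesis
    proof (rule monochromatic_if_many_parts)
      fix l assume "l < k"
      then show "finite (U (\<beta> l))" "N \<le> card (U (\<beta> l))" "U (\<beta> l) \<subseteq> {..<n}"
        using fin_U \<beta>(1) by (auto simp: big_def U_def)
      fix l' assume l': "l' < k" "l \<noteq> l'"
      then have ne: "\<beta> l \<noteq> \<beta> l'" "\<beta> l \<noteq> q" "\<beta> l' \<noteq> q"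
        using \<open>l < k\<close> \<beta> by (auto simp: inj_on_def big_def)
      then show disj: "U (\<beta> l) \<inter> U (\<beta> l') = {}"
        using disj_U by blast
      fix x y assume xy: "x \<in> U (\<beta> l)" "y \<in> U (\<beta> l')"
      then have "x < n" "y < n" "x \<noteq> y"
        using disj by (auto simp: U_def)
      then have "x \<in> U (c {x, y})" "y \<in> U (c {x, y})"
        by (auto simp: U_def insert_commute)
      then show "c {x, y} = q"
        using ne disj_U xy by metis
    qed
  next
    case False
    then have "card big \<le> card {2..k}"
      by simp
    then obtain g where g: "g ` big \<subseteq> {2..k}" "inj_on g big"
      using card_le_inj[OF fin_big finite_atLeastAtMost] by blast
    \<comment> \<open>Color 1 is reserved for \<open>q\<close>. Small classes may share 2 with a
      large one, since no component of a copy fits into a small class.\<close>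
    define c' where "c' e = (if c e = q then 1 else if c e \<in> big then g (c e) else 2)" for e
    have g_range: "g j \<in> {2..k}" if "j \<in> big" for j
      using g(1) that by blast
    have c'_neq: "c' e \<noteq> 1" if "c e \<noteq> q" for e
      using that g_range[of "c e"] by (cases "c e \<in> big") (auto simp: c'_def)
    have "c' ` nsets {..<n} 2 \<subseteq> {1..k}"
      using k g_range by (fastforce simp: c'_def)
    then have "has_monochromatic (complete_graph n) c' H"
      using arr by (simp add: arrows_def)
    then obtain \<phi> a where \<phi>: "inj_on \<phi> (verts H)" "\<phi> ` verts H \<subseteq> {..<n}"
      and a: "\<And>u v. {u, v} \<in> edges H \<Longrightarrow> c' {\<phi> u, \<phi> v} = a"
      by (rule has_monochromaticE) (rule that)
    show ?thesis
    proof (cases "a = 1")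
      case True
      have "c {\<phi> x, \<phi> y} = q" if "{x, y} \<in> edges H" for x y
        using a[OF that] True c'_neq by blast
      then show ?thesis
        using has_monochromaticI[OF simple_H \<phi>] by blast
    next
      case False
      have range: "\<phi> (i, v) < n" if "i \<in> {1..t}" "v \<in> verts (G i)" for i v
        using \<phi>(2) that by (meson image_subset_iff lessThan_iff mem_verts_H)
      have ne: "\<phi> (i, u) \<noteq> \<phi> (i, v)" if "i \<in> {1..t}" "{u, v} \<in> edges (G i)" for i u v
        using inj_onD[OF \<phi>(1)] simple_graph_edgeD[OF simple[OF that(1)] that(2)] that(1)
        by (metis mem_verts_H prod.inject)
      have nq: "c {\<phi> (i, u), \<phi> (i, v)} \<noteq> q" if "i \<in> {1..t}" "{u, v} \<in> edges (G i)" for i u v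
        using a[OF edge_H[OF that]] False by (auto simp: c'_def)
      \<comment> \<open>Along a component without color \<open>q\<close> the color cannot change at
        a vertex, so all \<open>N\<close> vertices stay in one \<open>U j\<close>, which is
        therefore large.\<close>
      have in_big: "c {\<phi> (i, u), \<phi> (i, v)} \<in> big" if i: "i \<in> {1..t}" and uv: "{u, v} \<in> edges (G i)" for i u v
      proof -
        define j where "j = c {\<phi> (i, u), \<phi> (i, v)}"
        have verts: "u \<in> verts (G i)" "v \<in> verts (G i)"
          using simple_graph_edgeD[OF simple[OF i] uv] by auto
        have "(\<lambda>v. \<phi> (i, v)) ` verts (G i) \<subseteq> U j"
        proof (rule connected_image_subset[OF connected[OF i] verts(1)])
          show "\<phi> (i, u) \<in> U j"
            using verts range[OF i] ne[OF i uv] by (auto simp: U_def j_def)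
          fix x y assume xy: "{x, y} \<in> edges (G i)" "\<phi> (i, x) \<in> U j"
          have xy': "\<phi> (i, x) < n" "\<phi> (i, y) < n"
            using simple_graph_edgeD[OF simple[OF i] xy(1)] range[OF i] by auto
          then have "\<phi> (i, x) \<in> U (c {\<phi> (i, x), \<phi> (i, y)})" "\<phi> (i, y) \<in> U (c {\<phi> (i, x), \<phi> (i, y)})"
            using ne[OF i xy(1)] by (auto simp: U_def insert_commute)
          moreover have "j = c {\<phi> (i, x), \<phi> (i, y)}"
            using disj_U[OF _ _ xy(2)] nq[OF i uv] nq[OF i xy(1)] calculation(1) by (simp add: j_def)
          ultimately show "\<phi> (i, y) \<in> U j"
            by simp
        qed
        from card_mono[OF fin_U this] have "N \<le> card (U j)"
          by (simp add: component_image[OF \<phi>(1) i])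
        moreover have "{\<phi> (i, u), \<phi> (i, v)} \<in> nsets {..<n} 2"
          using verts range[OF i] ne[OF i uv] by simp
        ultimately show ?thesis
          using nq[OF i uv] by (auto simp: big_def j_def)
      qed
      have "c {\<phi> x, \<phi> y} = inv_into big g a" if "{x, y} \<in> edges H" for x y
      proof -
        obtain i u v where i: "i \<in> {1..t}" "{u, v} \<in> edges (G i)" "{x, y} = {(i, u), (i, v)}"
          using \<open>{x, y} \<in> edges H\<close> by (rule edge_HE)
        then have "{\<phi> x, \<phi> y} = {\<phi> (i, u), \<phi> (i, v)}"
          by (metis image_insert image_empty)
        then have "c {\<phi> x, \<phi> y} \<in> big" "c {\<phi> x, \<phi> y} \<noteq> q"
          using in_big nq i by auto
        moreover have "c' {\<phi> x, \<phi> y} = a"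
          using a that by blast
        ultimately show ?thesis
          using g(2) by (auto simp: c'_def)
      qed
      then show ?thesis
        using has_monochromaticI[OF simple_H \<phi>] by blast
    qed
  qed
qed

section \<open>Combining the cases\<close>

lemma monochromatic_or_rainbow:
  assumes arr: "arrows n k H"
  shows "has_monochromatic (complete_graph n) c H \<or> has_rainbow (complete_graph n) c (path_graph 5)"
proof (rule disjCI)
  assume "\<not> has_rainbow (complete_graph n) c (path_graph 5)"
  then interpret p5_free "{..<n}" "\<lambda>x y. c {x, y}"
    by (rule p5_free_if_no_rainbow)
  \<comment> \<open>The first two cases leave \<open>H\<close> with at most one edge; the lower
    bound on \<open>n\<close> is for the third.\<close>
  consider "N \<le> 1" | "t * N \<le> 2" | (large) "2 \<le> N" "3 \<le> t * N"
    by linarith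
  then show "has_monochromatic (complete_graph n) c H"
  proof cases
    case 1
    have "edges H = {}"
    proof (rule ccontr)
      assume "edges H \<noteq> {}"
      then obtain e where "e \<in> edges H"
        by blast
      then obtain i u v where i: "i \<in> {1..t}" "{u, v} \<in> edges (G i)"
        by (rule edge_HE)
      then have "{u, v} \<subseteq> verts (G i)" "card {u, v} = 2"
        using simple_graph_edgeD[OF simple[OF i(1)] i(2)] by auto
      then show False
        using card_mono[OF finite_verts[OF i(1)], of "{u, v}"] card_verts[OF i(1)] 1 by simp
    qed
    then show ?thesis
      using arr k by (intro monochromatic_if_one_edge[OF simple_H]) auto
  next
    case 2
    have fin: "finite (verts H)"
      using simple_H by (simp add: simple_graph_def)
    have "e = verts H" if "e \<in> edges H" for e
    proof -
      have "e \<subseteq> verts H" "card e = 2"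
        using that simple_H by (auto simp: simple_graph_def nsets_def)
      then show ?thesis
        using 2 card_H by (intro card_seteq fin) auto
    qed
    then show ?thesis
      using arr k by (intro monochromatic_if_one_edge[OF simple_H]) auto
  next
    case large
    have m: "card (verts H) + 2 \<le> n"
      using lower_bound[OF arr] large card_H by simp
    have colors: "{c {x, y} | x y. x \<in> {..<n} \<and> y \<in> {..<n} \<and> x \<noteq> y} = c ` nsets {..<n} 2"
      by (auto simp: nsets_2_eq)
    show ?thesis
    proof (cases "card (c ` nsets {..<n} 2) \<le> 3")
      case True
      then show ?thesis
        using few_colors_imp_monochromatic[OF simple_H arr] k by simp
    next
      case False
      then consider (dom) q where "dominating q" | (near) q a b X where "near_clique q a b X"
        using dominating_or_near_clique m large card_H colors by fastforce
      then show ?thesis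
      proof cases
        case dom
        then show ?thesis
          using monochromatic_if_dominating[OF arr, of c q] by (auto simp: dominating_def)
      next
        case near
        then have ab: "a < n" "b < n" "a \<noteq> b" and X: "X \<subseteq> {..<n} - {a, b}" "n \<le> card X + 4"
          and q: "\<And>x y. \<lbrakk>x \<in> X; y \<in> X \<union> {a, b}; x \<noteq> y\<rbrakk> \<Longrightarrow> c {x, y} = q"
          by (auto simp: near_clique_def)
        have loop: "{u} \<notin> edges H" for u
          using simple_graph_edgeD(3)[OF simple_H, of u u] by auto
        \<comment> \<open>Here \<open>X\<close> has at least \<open>n - 4\<close> vertices. If
          \<open>H\<close> is not complete, a nonadjacent pair together with
          \<open>n \<ge> |H| + 2\<close> suffices; if it is, a single vertex together with
          \<open>n \<ge> |H| + 3\<close>.\<close>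
        have "\<exists>T\<subseteq>verts H. card T \<le> 2 \<and> (\<forall>u\<in>T. \<forall>v\<in>T. {u, v} \<notin> edges H) \<and>
          card (verts H) \<le> card X + card T"
        proof (cases "\<exists>u\<in>verts H. \<exists>v\<in>verts H. u \<noteq> v \<and> {u, v} \<notin> edges H")
          case True
          then obtain u v where "u \<in> verts H" "v \<in> verts H" "u \<noteq> v" "{u, v} \<notin> edges H"
            by blast
          then show ?thesis
            using m X(2) loop by (intro exI[of _ "{u, v}"]) (auto simp: insert_commute)
        next
          case False
          have "card (verts H) + 3 \<le> n"
          proof (rule arrows_complete_lower_bound[OF simple_H _ _ arr])
            show "3 \<le> card (verts H)" "2 \<le> k"
              using large card_H k by auto
            show "{u, v} \<in> edges H" if "u \<in> verts H" "v \<in> verts H" "u \<noteq> v" for u v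
              using False that by blast
          qed
          moreover have "verts H \<noteq> {}"
            using large card_H by auto
          then obtain u where "u \<in> verts H"
            by blast
          ultimately show ?thesis
            using X(2) loop by (intro exI[of _ "{u}"]) auto
        qed
        then obtain T where T: "T \<subseteq> verts H" "card T \<le> 2"
          "\<And>u v. \<lbrakk>u \<in> T; v \<in> T\<rbrakk> \<Longrightarrow> {u, v} \<notin> edges H" "card (verts H) \<le> card X + card T"
          by blast
        show ?thesis
        proof (rule monochromatic_if_near_clique[OF simple_H T(1,2) _ T(4) ab X(1)])
          show "{u, v} \<notin> edges H" if "u \<in> T" "v \<in> T" for u v
            using T(3) that .
          show "c {x, y} = q" if "x \<in> X" "y \<in> X \<union> {a, b}" "x \<noteq> y" for x y
            using q that .
        qed
      qed
    qed
  qed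
qed

end

theorem theorem1p5:
  fixes G :: "nat \<Rightarrow> 'a sgraph" and t p k :: nat
  assumes "1 \<le> t"
    and "\<And>i. i \<in> {1..t} \<Longrightarrow> simple_graph (G i)"
    and "\<And>i. i \<in> {1..t} \<Longrightarrow> connected_graph (G i)"
    and "homological p t G"
    and "k = Max {t, p, 3}"
  shows "mono_rainbow_number (disjoint_union t G) (path_graph 5)
           \<le> ramsey_number k (disjoint_union t G)"
proof -
  obtain s where s: "\<forall>i\<in>{1..t}. \<exists>c. proper_vertex_coloring (G i) p c \<and>
      (\<forall>j\<in>{1..p}. card {v \<in> verts (G i). c v = j} = s j)"
    using assms(4) by (auto simp: homological_def)
  then obtain col where col: "\<forall>i\<in>{1..t}. proper_vertex_coloring (G i) p (col i) \<and>
      (\<forall>j\<in>{1..p}. card {v \<in> verts (G i). col i v = j} = s j)"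
    by (rule bchoice[THEN exE])
  interpret homological_graphs G t p k "card (verts (G 1))" s col
  proof
    show "card (verts (G i)) = card (verts (G 1))" if "i \<in> {1..t}" for i
    proof -
      have "1 \<in> {1..t}"
        using assms(1) by simp
      then show ?thesis
        using assms(4) that unfolding homological_def by blast
    qed
  qed (use assms(1-3,5) col in auto)
  \<comment> \<open>The left side is a least number, so its defining property need only be checked
    at the Ramsey number.\<close>
  show ?thesis
    unfolding mono_rainbow_number_def
    by (intro Least_le allI monochromatic_or_rainbow arrows_ramsey_number simple_H)
qed

end
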